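(* Let $a,b,c\in\mathbb{R}$ with $a\neq 0$, let $g:\mathbb{R}\to\mathbb{R}$, $g(x)=ax^2+bx+c$, and let $\delta:=b^2-4ac-2b-7$. Let $(x,y,z)$ be a representative of a 3-cycle of the map $x_{t+1}=g(x_t)$ and let $r=\frac{z-y}{y-x}$. Let $q^{\langle0\rangle}_1<q^{\langle0\rangle}_2<q^{\langle0\rangle}_3$ be the roots of $Q_0(X)=X^3+X^2-2X-1$, so $q^{\langle0\rangle}_1\approx-1.801$, $q^{\langle0\rangle}_2\approx-0.445$, $q^{\langle0\rangle}_3\approx1.246$. Then: (i) $\delta=0$ if and only if $r\in\{q^{\langle0\rangle}_1,q^{\langle0\rangle}_2,q^{\langle0\rangle}_3\}$. (ii) $\delta>0$ and $(x,y,z)$ is a representative of $\mathcal{C}_{\langle\delta\rangle}$ if and only if $r\in(q^{\langle0\rangle}_1,-1)\cup(q^{\langle0\rangle}_2,0)\cup(q^{\langle0\rangle}_3,\infty)$. (iii) $\delta>0$ and $(x,y,z)$ is a representative of $\mathcal{C}_{\langle-\delta\rangle}$ if and only if $r\in(-\infty,q^{\langle0\rangle}_1)\cup(-1,q^{\langle0\rangle}_2)\cup(0,q^{\langle0\rangle}_3)$.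
   Context: A 3-cycle of the map $x_{t+1}=g(x_t)$ is the class, modulo cyclic permutation, of an ordered triple $(x,y,z)$ of pairwise distinct real numbers with $g(x)=y$, $g(y)=z$, $g(z)=x$; any such triple is called a representative of the 3-cycle, and $x,y,z$ are its points. For $\beta\in\mathbb{R}$ let $Q_\beta(X)=X^3+(1-\beta)X^2-(2+\beta)X-1$. All roots of $Q_\beta$ are real, distinct and nonzero; they are denoted $q^{\langle\beta\rangle}_1<q^{\langle\beta\rangle}_2<q^{\langle\beta\rangle}_3$. If $\delta<0$ the map has no 3-cycle, and if $\delta=0$ it has exactly one. For $\delta>0$ the map has exactly two 3-cycles: $\mathcal{C}_{\langle\delta\rangle}$, whose points are $\frac{-b+\sqrt{\delta}+1}{2a}+\frac{1}{a q^{\langle\sqrt{\delta}\rangle}_i}$, and $\mathcal{C}_{\langle-\delta\rangle}$, whose points are $\frac{-b-\sqrt{\delta}+1}{2a}+\frac{1}{a q^{\langle-\sqrt{\delta}\rangle}_i}$, $i\in\{1,2,3\}$. *)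

theory Defs
  imports Complex_Main "HOL-Computational_Algebra.Polynomial"
begin

definition is_three_cycle_rep :: "(real \<Rightarrow> real) \<Rightarrow> real \<Rightarrow> real \<Rightarrow> real \<Rightarrow> bool" where
  "is_three_cycle_rep g x y z \<longleftrightarrow>
     x \<noteq> y \<and> y \<noteq> z \<and> x \<noteq> z \<and> g x = y \<and> g y = z \<and> g z = x"

text \<open>A 3-cycle is identified with the set of its three representatives, i.e. with the
  equivalence class of a representative under cyclic permutation.\<close>

definition three_cycles :: "(real \<Rightarrow> real) \<Rightarrow> (real \<times> real \<times> real) set set" where
  "three_cycles g = {{(x, y, z), (y, z, x), (z, x, y)} | x y z. is_three_cycle_rep g x y z}"

text \<open>The 3-cycle of \<open>g\<close> with set of points \<open>P\<close>. Since \<open>g\<close> determines the cyclic order of the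
  points, there is at most one such 3-cycle, so that the collection of all representatives
  with points \<open>P\<close> is a single class (see \<open>three_cycle_with_points_eq\<close>), or empty if there is no
  such 3-cycle.\<close>

definition three_cycle_with_points ::
    "(real \<Rightarrow> real) \<Rightarrow> real set \<Rightarrow> (real \<times> real \<times> real) set" where
  "three_cycle_with_points g P = {(x, y, z). is_three_cycle_rep g x y z \<and> {x, y, z} = P}"

definition quad_map :: "real \<Rightarrow> real \<Rightarrow> real \<Rightarrow> real \<Rightarrow> real" where
  "quad_map a b c x = a * x\<^sup>2 + b * x + c"

definition delta :: "real \<Rightarrow> real \<Rightarrow> real \<Rightarrow> real" where
  "delta a b c = b\<^sup>2 - 4 * a * c - 2 * b - 7"

definition Q :: "real \<Rightarrow> real poly" where
  "Q \<beta> = [:- 1, - (2 + \<beta>), 1 - \<beta>, 1:]"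

text \<open>\<open>q \<beta> i\<close> is the \<open>i\<close>-th smallest root of \<open>Q \<beta>\<close>, with \<open>i \<in> {1, 2, 3}\<close>.\<close>

definition q :: "real \<Rightarrow> nat \<Rightarrow> real" where
  "q \<beta> i = sorted_list_of_set {x. poly (Q \<beta>) x = 0} ! (i - 1)"

text \<open>The points of the two 3-cycles; the parameter \<open>s\<close> is \<open>sqrt \<delta>\<close> or \<open>- sqrt \<delta>\<close>.\<close>

definition cycle_points :: "real \<Rightarrow> real \<Rightarrow> real \<Rightarrow> real set" where
  "cycle_points a b s = {(- b + s + 1) / (2 * a) + 1 / (a * q s i) | i. i \<in> {1, 2, 3}}"

text \<open>The 3-cycles \<open>C\<^sub>\<langle>\<^sub>\<delta>\<^sub>\<rangle>\<close> and \<open>C\<^sub>\<langle>\<^sub>-\<^sub>\<delta>\<^sub>\<rangle>\<close>, meaningful for \<open>a \<noteq> 0\<close> and \<open>\<delta> > 0\<close>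
  (see \<open>cycle_plus_in_three_cycles\<close>, \<open>cycle_minus_in_three_cycles\<close>).\<close>

definition cycle_plus :: "real \<Rightarrow> real \<Rightarrow> real \<Rightarrow> (real \<times> real \<times> real) set" where
  "cycle_plus a b c =
     three_cycle_with_points (quad_map a b c) (cycle_points a b (sqrt (delta a b c)))"

definition cycle_minus :: "real \<Rightarrow> real \<Rightarrow> real \<Rightarrow> (real \<times> real \<times> real) set" where
  "cycle_minus a b c =
     three_cycle_with_points (quad_map a b c) (cycle_points a b (- sqrt (delta a b c)))"

lemma three_cycle_with_points_eq:
  assumes "is_three_cycle_rep g x y z"
  shows "three_cycle_with_points g {x, y, z} = {(x, y, z), (y, z, x), (z, x, y)}"
proof -
  have fwd: "(u, v, w) \<in> {(x, y, z), (y, z, x), (z, x, y)}"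
    if uvw: "is_three_cycle_rep g u v w" "{u, v, w} = {x, y, z}" for u v w
  proof -
    have "u = x \<or> u = y \<or> u = z" using uvw(2) by blast
    moreover have "v = g u" "w = g v" using uvw(1) by (simp_all add: is_three_cycle_rep_def)
    moreover have "g x = y" "g y = z" "g z = x"
      using assms by (simp_all add: is_three_cycle_rep_def)
    ultimately have "(u, v, w) = (x, y, z) \<or> (u, v, w) = (y, z, x) \<or> (u, v, w) = (z, x, y)"
      by metis
    thus ?thesis by blast
  qed
  have sub: "three_cycle_with_points g {x, y, z} \<subseteq> {(x, y, z), (y, z, x), (z, x, y)}"
    unfolding three_cycle_with_points_def
    by (intro subsetI, elim CollectE case_prodE conjE, hypsubst, rule fwd)
  have "{y, z, x} = {x, y, z}" "{z, x, y} = {x, y, z}" by blast+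
  moreover have "is_three_cycle_rep g y z x" "is_three_cycle_rep g z x y"
    using assms unfolding is_three_cycle_rep_def by metis+
  ultimately have "{(x, y, z), (y, z, x), (z, x, y)} \<subseteq> three_cycle_with_points g {x, y, z}"
    using assms
    unfolding three_cycle_with_points_def insert_subset mem_Collect_eq prod.case
    by (intro conjI empty_subsetI refl)
  with sub show ?thesis by (rule subset_antisym)
qed

lemma poly_Q: "poly (Q \<beta>) x = x ^ 3 + (1 - \<beta>) * x\<^sup>2 - (2 + \<beta>) * x - 1"
  by (simp add: Q_def algebra_simps power2_eq_square power3_eq_cube)

lemma Q_root_step:
  assumes "poly (Q \<beta>) t = 0"
  shows "t \<noteq> 0" "t \<noteq> - 1" "poly (Q \<beta>) (- (1 + t) / t) = 0"
proof -
  have e: "t ^ 3 + (1 - \<beta>) * t\<^sup>2 - (2 + \<beta>) * t - 1 = 0"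
    using assms by (simp add: poly_Q)
  show 0: "t \<noteq> 0" and "t \<noteq> - 1" using e by auto
  have "poly (Q \<beta>) (- (1 + t) / t) * t ^ 3 =
      - ((1 + t) ^ 3) + (1 - \<beta>) * (1 + t)\<^sup>2 * t + (2 + \<beta>) * (1 + t) * t\<^sup>2 - t ^ 3"
    using 0 by (simp add: poly_Q field_simps power2_eq_square power3_eq_cube)
  also have "\<dots> = t ^ 3 + (1 - \<beta>) * t\<^sup>2 - (2 + \<beta>) * t - 1"
    by (simp add: algebra_simps power2_eq_square power3_eq_cube)
  finally show "poly (Q \<beta>) (- (1 + t) / t) = 0" using e 0 by simp
qed

lemma no_fixed: "(t::real) \<noteq> 0 \<Longrightarrow> - (1 + t) / t \<noteq> t"
proof
  assume "t \<noteq> 0" "- (1 + t) / t = t"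
  hence "t\<^sup>2 + t + 1 = 0" by (simp add: field_simps power2_eq_square)
  moreover have "t\<^sup>2 + t + 1 = (t + 1/2)\<^sup>2 + 3/4" by (simp add: power2_eq_square algebra_simps)
  moreover have "(t + 1/2)\<^sup>2 \<ge> 0" by simp
  ultimately show False by linarith
qed

lemma Q_roots:
  obtains t where "poly (Q \<beta>) t = 0" "distinct [t, - (1 + t) / t, - 1 / (1 + t)]"
    "{x. poly (Q \<beta>) x = 0} = {t, - (1 + t) / t, - 1 / (1 + t)}"
proof -
  have "\<exists>t. t > - 1 \<and> t < 0 \<and> poly (Q \<beta>) t = 0"
    by (rule poly_IVT_neg) (simp_all add: poly_Q)
  then obtain t where t: "poly (Q \<beta>) t = 0" by blast
  let ?u = "- (1 + t) / t" and ?v = "- 1 / (1 + t)"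
  have t0: "t \<noteq> 0" "1 + t \<noteq> 0" using Q_root_step(1,2)[OF t] by auto
  have uv: "- (1 + ?u) / ?u = ?v" using t0 by (simp add: field_simps)
  have vt: "- (1 + ?v) / ?v = t" using t0 by (simp add: field_simps)
  have u: "poly (Q \<beta>) ?u = 0" by (rule Q_root_step(3)[OF t])
  have v: "poly (Q \<beta>) ?v = 0" using Q_root_step(3)[OF u] uv by metis
  have d: "distinct [t, ?u, ?v]"
    using no_fixed[OF Q_root_step(1)[OF t]] no_fixed[OF Q_root_step(1)[OF u]]
      no_fixed[OF Q_root_step(1)[OF v]] uv vt by (metis distinct_length_2_or_more
        distinct_singleton)
  have Q0: "Q \<beta> \<noteq> 0" by (simp add: Q_def)
  have "card {x. poly (Q \<beta>) x = 0} \<le> 3"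
    using card_poly_roots_bound[OF Q0] by (simp add: Q_def)
  moreover have "card {t, ?u, ?v} = 3" using d by simp
  moreover have "{t, ?u, ?v} \<subseteq> {x. poly (Q \<beta>) x = 0}" using t u v by simp
  ultimately have "{x. poly (Q \<beta>) x = 0} = {t, ?u, ?v}"
    using card_seteq[of "{x. poly (Q \<beta>) x = 0}" "{t, ?u, ?v}"] poly_roots_finite[OF Q0]
    by simp
  with t d show ?thesis by (rule that)
qed

lemma q_set: "{q \<beta> i | i. i \<in> {1, 2, 3}} = {x. poly (Q \<beta>) x = 0}"
proof -
  let ?R = "{x. poly (Q \<beta>) x = 0}"
  let ?l = "sorted_list_of_set ?R"
  have f: "finite ?R" by (rule poly_roots_finite) (simp add: Q_def)
  obtain t where "distinct [t, - (1 + t) / t, - 1 / (1 + t)]"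
      "?R = {t, - (1 + t) / t, - 1 / (1 + t)}"
    by (rule Q_roots)
  hence "card ?R = 3" by simp
  hence len: "length ?l = 3" by simp
  let ?u = "?l ! 0" and ?v = "?l ! 1" and ?w = "?l ! 2"
  have "?R = {?l ! i | i. i < 3}"
    unfolding len[symmetric] set_conv_nth[symmetric] set_sorted_list_of_set[OF f] ..
  also have "\<dots> = {?u, ?v, ?w}"
  proof -
    have "i < 3 \<longleftrightarrow> i = 0 \<or> i = 1 \<or> i = 2" for i :: nat by auto
    thus ?thesis by auto
  qed
  finally have "?R = {?u, ?v, ?w}" .
  moreover have "{q \<beta> i | i. i \<in> {1, 2, 3}} = {q \<beta> 1, q \<beta> 2, q \<beta> 3}" by auto
  ultimately show ?thesis unfolding q_def by simp
qed

lemma q_strict_mono: "q \<beta> 1 < q \<beta> 2" "q \<beta> 2 < q \<beta> 3"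
proof -
  let ?R = "{x. poly (Q \<beta>) x = 0}"
  obtain t where "distinct [t, - (1 + t) / t, - 1 / (1 + t)]"
      "?R = {t, - (1 + t) / t, - 1 / (1 + t)}"
    by (rule Q_roots)
  hence "card ?R = 3" by simp
  hence len: "length (sorted_list_of_set ?R) = 3" by simp
  have *: "q \<beta> i < q \<beta> j" if "i - 1 < j - 1" "j - 1 < 3" for i j
    unfolding q_def
    by (rule sorted_wrt_nth_less[OF strict_sorted_list_of_set]) (use that len in simp_all)
  show "q \<beta> 1 < q \<beta> 2" "q \<beta> 2 < q \<beta> 3" by (rule *; simp)+
qed

lemma quad_map_point:
  assumes "a \<noteq> 0" "s\<^sup>2 = delta a b c" "poly (Q s) t = 0"
  shows "quad_map a b c ((- b + s + 1) / (2 * a) + 1 / (a * t)) =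
    (- b + s + 1) / (2 * a) + 1 / (a * (- (1 + t) / t))"
proof -
  have t0: "t \<noteq> 0" "1 + t \<noteq> 0" using Q_root_step(1,2)[OF assms(3)] by auto
  define k where "k = 1 / t"
  define m where "m = t / (1 + t)"
  define p where "p = (- b + s + 1) / (2 * a) + k / a"
  have kt: "k * t = 1" using t0 by (simp add: k_def)
  have "(- 2 + (s + 1) * k + k\<^sup>2) * (t\<^sup>2 * (1 + t)) =
      (- 2 * t\<^sup>2 + (s + 1) * (k * t) * t + (k * t)\<^sup>2) * (1 + t)"
    by (simp add: algebra_simps power2_eq_square)
  also have "\<dots> = - (t ^ 3) - poly (Q s) t"
    by (simp add: kt poly_Q algebra_simps power2_eq_square power3_eq_cube)
  also have "\<dots> = - m * (t\<^sup>2 * (1 + t))"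
    using t0 assms(3) by (simp add: m_def power2_eq_square power3_eq_cube)
  finally have km: "- 2 + (s + 1) * k + k\<^sup>2 = - m"
    using t0 mult_right_cancel[of "t\<^sup>2 * (1 + t)"] by (metis no_zero_divisors power_not_zero)
  have "a * p = ((s + 1) / 2 + k) - b / 2"
    using assms(1) by (simp add: p_def field_simps)
  hence "2 * (a * p) = s + 1 + 2 * k - b" by simp
  hence "4 * (a * quad_map a b c p) =
      (s + 1 + 2 * k - b)\<^sup>2 + 2 * b * (s + 1 + 2 * k - b) + 4 * a * c"
    unfolding quad_map_def by algebra
  also have "\<dots> = 2 * (- b + s + 1) + 4 * (- 2 + (s + 1) * k + k\<^sup>2)"
    using assms(2) unfolding delta_def by algebra
  finally have "a * quad_map a b c p = (- b + s + 1) / 2 - m"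
    unfolding km by (simp add: field_simps)
  hence "quad_map a b c p = ((- b + s + 1) / 2 - m) / a"
    using assms(1) by (simp add: nonzero_eq_divide_eq mult.commute)
  hence "quad_map a b c p = (- b + s + 1) / (2 * a) - m / a"
    by (simp add: diff_divide_distrib)
  moreover have "1 / (a * (- (1 + t) / t)) = - m / a"
  proof -
    have "1 / (a * (- n / t)) = - (t / n) / a" for n
      by (simp add: divide_inverse mult.commute)
    thus ?thesis unfolding m_def .
  qed
  moreover have "p = (- b + s + 1) / (2 * a) + 1 / (a * t)"
    by (simp add: p_def k_def mult.commute)
  ultimately show ?thesis by simp
qed

lemma cycle_points_eq:
  "cycle_points a b s =
    (\<lambda>t. (- b + s + 1) / (2 * a) + 1 / (a * t)) ` {t. poly (Q s) t = 0}"
  unfolding q_set[symmetric] cycle_points_def by blast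

lemma three_cycle_with_points_in_three_cycles:
  assumes "a \<noteq> 0" "s\<^sup>2 = delta a b c"
  shows "three_cycle_with_points (quad_map a b c) (cycle_points a b s)
    \<in> three_cycles (quad_map a b c)"
proof -
  let ?f = "\<lambda>t. (- b + s + 1) / (2 * a) + 1 / (a * t)"
  obtain t where t: "poly (Q s) t = 0"
    and d: "distinct [t, - (1 + t) / t, - 1 / (1 + t)]"
    and R: "{x. poly (Q s) x = 0} = {t, - (1 + t) / t, - 1 / (1 + t)}"
    by (rule Q_roots)
  let ?u = "- (1 + t) / t" and ?v = "- 1 / (1 + t)"
  have t0: "t \<noteq> 0" "1 + t \<noteq> 0" using Q_root_step(1,2)[OF t] by auto
  have uv: "- (1 + ?u) / ?u = ?v" using t0 by (simp add: field_simps)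
  have vt: "- (1 + ?v) / ?v = t" using t0 by (simp add: field_simps)
  have u: "poly (Q s) ?u = 0" and v: "poly (Q s) ?v = 0" using R by auto
  have inj: "?f x \<noteq> ?f y" if "x \<noteq> y" for x y
    using that assms(1) by simp
  have "quad_map a b c (?f t) = ?f ?u" by (rule quad_map_point[OF assms t])
  moreover have "quad_map a b c (?f ?u) = ?f ?v"
    using quad_map_point[OF assms u] unfolding uv .
  moreover have "quad_map a b c (?f ?v) = ?f t"
    using quad_map_point[OF assms v] unfolding vt .
  moreover have "?f t \<noteq> ?f ?u" "?f ?u \<noteq> ?f ?v" "?f t \<noteq> ?f ?v"
  proof -
    have "t \<noteq> ?u" "?u \<noteq> ?v" "t \<noteq> ?v" using d by simp_all
    from this[THEN inj] show "?f t \<noteq> ?f ?u" "?f ?u \<noteq> ?f ?v" "?f t \<noteq> ?f ?v" .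
  qed
  ultimately have rep: "is_three_cycle_rep (quad_map a b c) (?f t) (?f ?u) (?f ?v)"
    unfolding is_three_cycle_rep_def by blast
  have "cycle_points a b s = {?f t, ?f ?u, ?f ?v}"
    unfolding cycle_points_eq R by simp
  hence "three_cycle_with_points (quad_map a b c) (cycle_points a b s) =
      {(?f t, ?f ?u, ?f ?v), (?f ?u, ?f ?v, ?f t), (?f ?v, ?f t, ?f ?u)}"
    using three_cycle_with_points_eq[OF rep] by (simp only:)
  with rep show ?thesis unfolding three_cycles_def by blast
qed

lemma cycle_plus_in_three_cycles:
  "a \<noteq> 0 \<Longrightarrow> delta a b c > 0 \<Longrightarrow> cycle_plus a b c \<in> three_cycles (quad_map a b c)"
  unfolding cycle_plus_def by (rule three_cycle_with_points_in_three_cycles) simp_all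

lemma cycle_minus_in_three_cycles:
  "a \<noteq> 0 \<Longrightarrow> delta a b c > 0 \<Longrightarrow> cycle_minus a b c \<in> three_cycles (quad_map a b c)"
  unfolding cycle_minus_def by (rule three_cycle_with_points_in_three_cycles) simp_all

end

theory Submission
  imports Defs
begin

text \<open>For a 3-cycle \<open>(x, y, z)\<close> with ratio \<open>r\<close>, the slopes \<open>a(x + y) + b\<close>, \<open>a(y + z) + b\<close>,
  \<open>a(z + x) + b\<close> are \<open>r\<close>, \<open>-(1 + r)/r\<close>, \<open>-1/(1 + r)\<close>, that is, the roots of the unique \<open>Q s\<close>
  that vanishes at \<open>r\<close>. Solving for the points gives \<open>x = (-b + s + 1)/(2a) + 1/(ar)\<close> and its
  cyclic analogues, and \<open>s\<^sup>2 = \<delta>\<close>; hence the sign of \<open>s = Q\<^sub>0(r)/(r(r + 1))\<close> decides which of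
  the two 3-cycles is represented.\<close>

lemma three_cycle_slopes:
  assumes cyc: "is_three_cycle_rep (quad_map a b c) x y z" and r: "r = (z - y) / (y - x)"
  shows "r \<noteq> 0" "1 + r \<noteq> 0" "a * (x + y) + b = r"
    "a * (y + z) + b = - (1 + r) / r" "a * (z + x) + b = - 1 / (1 + r)"
proof -
  have ne: "y - x \<noteq> 0" "z - y \<noteq> 0" "x - z \<noteq> 0"
    and g: "quad_map a b c x = y" "quad_map a b c y = z" "quad_map a b c z = x"
    using cyc unfolding is_three_cycle_rep_def by auto
  have zy: "z - y = r * (y - x)" and xz: "x - z = - (1 + r) * (y - x)"
    using r ne(1) by (simp_all add: field_simps)
  show r0: "r \<noteq> 0" and r1: "1 + r \<noteq> 0"
    using zy xz ne by auto
  have slope: "(a * (u + v) + b) * (v - u) = quad_map a b c v - quad_map a b c u" for u v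
    by (simp add: quad_map_def algebra_simps power2_eq_square)
  have "(a * (x + y) + b) * (y - x) = r * (y - x)"
    using slope[of x y] g zy by simp
  thus "a * (x + y) + b = r" using ne(1) by simp
  have "(a * (y + z) + b) * r * (y - x) = - (1 + r) * (y - x)"
    using slope[of y z] g zy xz by (simp add: mult.assoc)
  hence "(a * (y + z) + b) * r = - (1 + r)" using ne(1) by (metis mult_right_cancel)
  thus "a * (y + z) + b = - (1 + r) / r" using r0 by (simp add: nonzero_eq_divide_eq)
  have "(a * (z + x) + b) * (x - z) = y - x" using slope[of z x] g by simp
  hence "(a * (z + x) + b) * (1 + r) * (y - x) = - 1 * (y - x)" using xz by algebra
  hence "(a * (z + x) + b) * (1 + r) = - 1" using ne(1) by (metis mult_right_cancel)
  thus "a * (z + x) + b = - 1 / (1 + r)" by (simp only: nonzero_eq_divide_eq[OF r1])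
qed

lemma Q_root_sum:
  assumes "poly (Q s) r = 0"
  shows "r + - (1 + r) / r + - 1 / (1 + r) = s - 1"
proof -
  have n: "r \<noteq> 0" "1 + r \<noteq> 0" using Q_root_step(1,2)[OF assms] by auto
  have "(r + - (1 + r) / r + - 1 / (1 + r) - (s - 1)) * (r * (1 + r)) = poly (Q s) r"
    using n by (simp add: poly_Q divide_simps) algebra
  thus ?thesis using assms n by simp
qed

lemma three_cycle_point:
  assumes a: "a \<noteq> 0" and cyc: "is_three_cycle_rep (quad_map a b c) x y z"
    and r: "r = (z - y) / (y - x)" and Q: "poly (Q s) r = 0"
  shows "x = (- b + s + 1) / (2 * a) + 1 / (a * r)"
proof -
  note sl = three_cycle_slopes[OF cyc r]
  have "(a * (x + y) + b) + (a * (y + z) + b) + (a * (z + x) + b) = s - 1"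
    unfolding sl(3-5) by (rule Q_root_sum[OF Q])
  hence "2 * (a * x) + b = s - 1 - 2 * (a * (y + z) + b)" by algebra
  also have "\<dots> = s + 1 + 2 / r" unfolding sl(4) using sl(1) by (simp add: field_simps)
  finally show ?thesis using a sl(1) by (simp add: field_simps)
qed

lemma three_cycle_rep_rotate:
  assumes "is_three_cycle_rep (quad_map a b c) x y z" and "r = (z - y) / (y - x)"
  shows "is_three_cycle_rep (quad_map a b c) y z x" "- (1 + r) / r = (x - z) / (z - y)"
proof -
  show rot: "is_three_cycle_rep (quad_map a b c) y z x"
    using assms(1) by (auto simp: is_three_cycle_rep_def)
  show "- (1 + r) / r = (x - z) / (z - y)"
    using three_cycle_slopes(4)[OF assms] three_cycle_slopes(3)[OF rot refl] by simp
qed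

lemma three_cycle_parameter_square:
  assumes a: "a \<noteq> 0" and cyc: "is_three_cycle_rep (quad_map a b c) x y z"
    and r: "r = (z - y) / (y - x)" and Q: "poly (Q s) r = 0"
  shows "s\<^sup>2 = delta a b c"
proof -
  note sl = three_cycle_slopes[OF cyc r]
  have x: "2 * a * x + b = s + 1 + 2 / r"
    using three_cycle_point[OF assms] a sl(1) by (simp add: field_simps)
  have "a * y = r - b - a * x" using sl(3) by (simp add: algebra_simps)
  moreover have "y = a * x\<^sup>2 + b * x + c"
    using cyc by (simp add: is_three_cycle_rep_def quad_map_def)
  ultimately have "delta a b c = (2 * a * x + b)\<^sup>2 + 2 * (2 * a * x + b) - 4 * r - 7"
    unfolding delta_def by algebra
  also have "\<dots> = (s + 1 + 2 / r)\<^sup>2 + 2 * (s + 1 + 2 / r) - 4 * r - 7"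
    unfolding x ..
  also have "\<dots> - s\<^sup>2 = - 4 * poly (Q s) r / r\<^sup>2"
    using sl(1) by (simp add: poly_Q divide_simps) algebra
  finally show ?thesis using Q by simp
qed

lemma three_cycle_with_points_iff:
  assumes a: "a \<noteq> 0" and cyc: "is_three_cycle_rep (quad_map a b c) x y z"
    and r: "r = (z - y) / (y - x)" and s: "s\<^sup>2 = delta a b c"
  shows "(x, y, z) \<in> three_cycle_with_points (quad_map a b c) (cycle_points a b s)
    \<longleftrightarrow> poly (Q s) r = 0"
proof
  let ?f = "\<lambda>t. (- b + s + 1) / (2 * a) + 1 / (a * t)"
  assume "(x, y, z) \<in> three_cycle_with_points (quad_map a b c) (cycle_points a b s)"
  hence "x \<in> ?f ` {t. poly (Q s) t = 0}"
    unfolding three_cycle_with_points_def cycle_points_eq by blast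
  then obtain t where t: "poly (Q s) t = 0" and x: "x = ?f t" by blast
  have n: "t \<noteq> 0" "1 + t \<noteq> 0" using Q_root_step(1,2)[OF t] by auto
  have "y = ?f (- (1 + t) / t)"
    using quad_map_point[OF a s t] cyc x by (simp add: is_three_cycle_rep_def)
  hence "a * (x + y) + b = s + 1 + 1 / t - t / (1 + t)"
    using a n x by (simp add: divide_simps) algebra
  also have "\<dots> = t"
    using Q_root_sum[OF t] n by (simp add: divide_simps) algebra
  finally have "r = t" using three_cycle_slopes(3)[OF cyc r] by simp
  thus "poly (Q s) r = 0" using t by simp
next
  let ?f = "\<lambda>t. (- b + s + 1) / (2 * a) + 1 / (a * t)"
  assume Q: "poly (Q s) r = 0"
  note rot1 = three_cycle_rep_rotate[OF cyc r]
  note rot2 = three_cycle_rep_rotate[OF rot1]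
  note Q1 = Q_root_step(3)[OF Q]
  note Q2 = Q_root_step(3)[OF Q1]
  have "x = ?f r" "y = ?f (- (1 + r) / r)"
    "z = ?f (- (1 + - (1 + r) / r) / (- (1 + r) / r))"
    by (rule three_cycle_point[OF a cyc r Q] three_cycle_point[OF a rot1 Q1]
        three_cycle_point[OF a rot2 Q2])+
  hence sub: "{x, y, z} \<subseteq> cycle_points a b s"
    unfolding cycle_points_eq using Q Q1 Q2 by blast
  have "Q s \<noteq> 0" "card {u. poly (Q s) u = 0} \<le> 3"
    using card_poly_roots_bound[of "Q s"] by (simp_all add: Q_def)
  hence "finite (cycle_points a b s)" "card (cycle_points a b s) \<le> 3"
    unfolding cycle_points_eq using poly_roots_finite[of "Q s"]
    by (auto intro: card_image_le[THEN order_trans])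
  moreover have "card {x, y, z} = 3" using cyc by (simp add: is_three_cycle_rep_def)
  ultimately have "{x, y, z} = cycle_points a b s" using sub by (intro card_seteq) auto
  thus "(x, y, z) \<in> three_cycle_with_points (quad_map a b c) (cycle_points a b s)"
    using cyc by (simp add: three_cycle_with_points_def)
qed

lemma poly_Q_factor: "poly (Q \<beta>) u = (u - q \<beta> 1) * (u - q \<beta> 2) * (u - q \<beta> 3)"
proof -
  obtain t where t: "poly (Q \<beta>) t = 0" and d: "distinct [t, - (1 + t) / t, - 1 / (1 + t)]"
    and R: "{u. poly (Q \<beta>) u = 0} = {t, - (1 + t) / t, - 1 / (1 + t)}"
    by (rule Q_roots)
  have n: "t \<noteq> 0" "1 + t \<noteq> 0" using Q_root_step(1,2)[OF t] by auto
  have "{q \<beta> i | i. i \<in> {1, 2, 3}} = {q \<beta> 1, q \<beta> 2, q \<beta> 3}" by auto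
  hence eq: "{q \<beta> 1, q \<beta> 2, q \<beta> 3} = {t, - (1 + t) / t, - 1 / (1 + t)}"
    using q_set[of \<beta>] R by simp
  have s: "\<beta> = t + - (1 + t) / t + - 1 / (1 + t) + 1" using Q_root_sum[OF t] by simp
  have "poly (Q \<beta>) u = (u - t) * (u - - (1 + t) / t) * (u - - 1 / (1 + t))"
    unfolding poly_Q s using n by (simp add: divide_simps) algebra
  also have "\<dots> = (\<Prod>v\<in>{t, - (1 + t) / t, - 1 / (1 + t)}. u - v)"
    using d by (simp add: mult.assoc)
  also have "\<dots> = (u - q \<beta> 1) * (u - q \<beta> 2) * (u - q \<beta> 3)"
    unfolding eq[symmetric] using q_strict_mono[of \<beta>] by (simp add: mult.assoc)
  finally show ?thesis .
qed

lemma q_bounds: "q \<beta> 1 < - 1" "- 1 < q \<beta> 2" "q \<beta> 2 < 0" "0 < q \<beta> 3"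
proof -
  note m = q_strict_mono[of \<beta>]
  have "(- 1 - q \<beta> 1) * (- 1 - q \<beta> 2) * (- 1 - q \<beta> 3) = 1"
    unfolding poly_Q_factor[symmetric] by (simp add: poly_Q)
  hence p1: "(- 1 - q \<beta> 1) * (- 1 - q \<beta> 2) * (- 1 - q \<beta> 3) > 0" by simp
  have "(0 - q \<beta> 1) * (0 - q \<beta> 2) * (0 - q \<beta> 3) = - 1"
    unfolding poly_Q_factor[symmetric] by (simp add: poly_Q)
  hence p0: "(0 - q \<beta> 1) * (0 - q \<beta> 2) * (0 - q \<beta> 3) < 0" by simp
  obtain t where t: "- 1 < t" "t < 0" "poly (Q \<beta>) t = 0"
    using poly_IVT_neg[of "- 1" 0 "Q \<beta>"] by (auto simp: poly_Q)
  have "t = q \<beta> 1 \<or> t = q \<beta> 2 \<or> t = q \<beta> 3" using t(3) by (auto simp: poly_Q_factor)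
  thus "q \<beta> 1 < - 1" "- 1 < q \<beta> 2" "q \<beta> 2 < 0" "0 < q \<beta> 3"
    using p0 p1 t(1,2) m by (auto simp: zero_less_mult_iff mult_less_0_iff)
qed

theorem theorem2p4:
  fixes a b c x y z r :: real
  assumes "a \<noteq> 0"
    and "is_three_cycle_rep (quad_map a b c) x y z"
    and "r = (z - y) / (y - x)"
  shows "(delta a b c = 0 \<longleftrightarrow> r \<in> {q 0 1, q 0 2, q 0 3})
    \<and> (delta a b c > 0 \<and> (x, y, z) \<in> cycle_plus a b c
        \<longleftrightarrow> r \<in> {q 0 1<..<- 1} \<union> {q 0 2<..<0} \<union> {q 0 3<..})
    \<and> (delta a b c > 0 \<and> (x, y, z) \<in> cycle_minus a b c
        \<longleftrightarrow> r \<in> {..<q 0 1} \<union> {- 1<..<q 0 2} \<union> {0<..<q 0 3})"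
proof -
  note n = three_cycle_slopes(1,2)[OF assms(2,3)]
  define s where "s = poly (Q 0) r / (r * (r + 1))"
  have Q_eq: "poly (Q \<beta>) r = (s - \<beta>) * (r * (r + 1))" for \<beta>
  proof -
    have "s * (r * (r + 1)) = poly (Q 0) r" using n by (simp add: s_def)
    thus ?thesis unfolding poly_Q by algebra
  qed
  have Q_iff: "poly (Q \<beta>) r = 0 \<longleftrightarrow> \<beta> = s" for \<beta>
    using n by (auto simp: Q_eq)
  have d: "delta a b c = s\<^sup>2"
    using three_cycle_parameter_square[OF assms, of s] Q_iff by simp
  have plus: "(x, y, z) \<in> cycle_plus a b c \<longleftrightarrow> \<bar>s\<bar> = s"
    unfolding cycle_plus_def
    using three_cycle_with_points_iff[OF assms, of "\<bar>s\<bar>"] Q_iff by (simp add: d)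
  have minus: "(x, y, z) \<in> cycle_minus a b c \<longleftrightarrow> - \<bar>s\<bar> = s"
    unfolding cycle_minus_def
    using three_cycle_with_points_iff[OF assms, of "- \<bar>s\<bar>"] Q_iff by (simp add: d)
  have s: "s = (r - q 0 1) * (r - q 0 2) * (r - q 0 3) / (r * (r + 1))"
    unfolding s_def poly_Q_factor ..
  note b = q_bounds[of 0]
  have zero: "s = 0 \<longleftrightarrow> r \<in> {q 0 1, q 0 2, q 0 3}"
    using n by (auto simp: s add.commute)
  have pos_if: "s > 0" if "r \<in> {q 0 1<..<- 1} \<union> {q 0 2<..<0} \<union> {q 0 3<..}"
  proof -
    consider "r - q 0 1 > 0" "r - q 0 2 < 0" "r - q 0 3 < 0" "r < 0" "r + 1 < 0"
      | "r - q 0 1 > 0" "r - q 0 2 > 0" "r - q 0 3 < 0" "r < 0" "r + 1 > 0"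
      | "r - q 0 1 > 0" "r - q 0 2 > 0" "r - q 0 3 > 0" "r > 0" "r + 1 > 0"
      using \<open>r \<in> _\<close> b by fastforce
    thus ?thesis
      unfolding s by cases
        (simp_all only: mult_pos_pos mult_pos_neg mult_neg_pos mult_neg_neg
          divide_pos_pos divide_neg_neg)
  qed
  have neg_if: "s < 0" if "r \<in> {..<q 0 1} \<union> {- 1<..<q 0 2} \<union> {0<..<q 0 3}"
  proof -
    consider "r - q 0 1 < 0" "r - q 0 2 < 0" "r - q 0 3 < 0" "r < 0" "r + 1 < 0"
      | "r - q 0 1 > 0" "r - q 0 2 < 0" "r - q 0 3 < 0" "r < 0" "r + 1 > 0"
      | "r - q 0 1 > 0" "r - q 0 2 > 0" "r - q 0 3 < 0" "r > 0" "r + 1 > 0"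
      using \<open>r \<in> _\<close> b by fastforce
    thus ?thesis
      unfolding s by cases
        (simp_all only: mult_pos_pos mult_pos_neg mult_neg_pos mult_neg_neg
          divide_neg_pos divide_pos_neg)
  qed
  have "r \<noteq> - 1" using n(2) by auto
  hence cover: "r \<in> {q 0 1, q 0 2, q 0 3}
      \<or> r \<in> {q 0 1<..<- 1} \<union> {q 0 2<..<0} \<union> {q 0 3<..}
      \<or> r \<in> {..<q 0 1} \<union> {- 1<..<q 0 2} \<union> {0<..<q 0 3}"
    using n(1) by auto
  have pos: "s > 0 \<longleftrightarrow> r \<in> {q 0 1<..<- 1} \<union> {q 0 2<..<0} \<union> {q 0 3<..}"
    using pos_if neg_if zero cover by (metis less_asym)
  have neg: "s < 0 \<longleftrightarrow> r \<in> {..<q 0 1} \<union> {- 1<..<q 0 2} \<union> {0<..<q 0 3}"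
    using pos_if neg_if zero cover by (metis less_asym)
  show ?thesis
    unfolding plus minus zero[symmetric] pos[symmetric] neg[symmetric] d by auto
qed

end
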